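(* Let $G$ be a finitely generated group and let $K$ be an algebraically closed field. Then there exist a finite algebraic group $X$ over $K$ and $\tau\in CA_{algr}(G,X,K)$ such that $\tau$ is $(\bullet\bullet)$-pre-injective but is not surjective.
   Context: Algebraic varieties and groups. An algebraic variety over an algebraically closed field $K$ is a reduced $K$-scheme of finite type, identified with its set of $K$-points. An algebraic group over $K$ is a group that is an algebraic variety whose group operations are algebraic morphisms; it is not assumed connected. Write $A = X(K)$ and let $e$ be the neutral element of $X$. Cellular automata. For a group $G$ and a set $A$, elements of $A^G$ are maps $c\colon G\to A$, with shift action $(gc)(h)=c(g^{-1}h)$. A cellular automaton is a map $\tau\colon A^G\to A^G$ for which there are a finite subset $M\subset G$ (a memory set) and a map $\mu\colon A^M\to A$ (a local defining map) with $(\tau(c))(g)=\mu((g^{-1}c)|_M)$ for all $c\in A^G$, $g\in G$. The set $CA_{algr}(G,X,K)$ consists of the cellular automata $\tau\colon A^G\to A^G$ admitting a finite memory set $M$ whose local defining map $\mu\colon A^M\to A$ is induced by a homomorphism of algebraic groups $X^M\to X$, where $X^M$ is the fibered product of copies of $X$ indexed by $M$. Weak pre-injectivity. For a finite $\Omega\subset G$ and $D\subset A^\Omega$, put $D_e = D\times\{e\}^{G\setminus\Omega}\subset A^G$. A cellular automaton $\tau\in CA_{algr}(G,X,K)$ is $(\bullet\bullet)$-pre-injective if $\dim(\tau((A^\Omega)_e))=\dim(A^\Omega)$ for every finite subset $\Omega\subset G$. Here $\dim$ is Krull dimension; if $M$ is a memory set of $\tau$, configurations in $\tau((A^\Omega)_e)$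 take the value $e$ outside the finite set $\Omega M^{-1}$, so by restriction $\tau((A^\Omega)_e)$ is identified with an algebraic subgroup of $A^{\Omega M^{-1}}$, and its dimension is taken there. *)

theory Defs
  imports
    "HOL-Analysis.Abstract_Topology"
    "HOL-Algebra.Product_Groups"
    "HOL-Computational_Algebra.Polynomial"
    "HOL-Library.Extended_Real"
begin

section \<open>Algebraic varieties over an algebraically closed field\<close>

text \<open>
  Over an algebraically closed field \<open>'k\<close>, a reduced scheme of finite type is determined by its set of
  \<open>'k\<close>-points, the Zariski topology on it, and the sheaf of \<open>'k\<close>-valued regular functions. So a variety
  is a space with functions that is covered by finitely many open pieces, each of them isomorphic to
  an algebraic set in some affine space. Neither irreducibility nor connectedness is required.

  Regular functions on \<open>U\<close> are represented by elements of \<open>extensional U\<close>. The values of \<open>regular X\<close> at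
  sets that are not open are irrelevant.
\<close>

record ('a, 'k) fun_space =
  zariski :: "'a topology"
  regular :: "'a set \<Rightarrow> ('a \<Rightarrow> 'k) set"

abbreviation points :: "('a, 'k) fun_space \<Rightarrow> 'a set" where
  "points X \<equiv> topspace (zariski X)"

definition space_with_functions :: "('a, 'k::field) fun_space \<Rightarrow> bool" where
  "space_with_functions X \<longleftrightarrow>
     (\<forall>U. openin (zariski X) U \<longrightarrow>
        regular X U \<subseteq> extensional U \<and>
        (\<forall>a. (\<lambda>x\<in>U. a) \<in> regular X U) \<and>
        (\<forall>f\<in>regular X U. \<forall>g\<in>regular X U.
           (\<lambda>x\<in>U. f x + g x) \<in> regular X U \<and> (\<lambda>x\<in>U. f x * g x) \<in> regular X U)) \<and>
     (\<forall>U V f. openin (zariski X) U \<and> openin (zariski X) V \<and> V \<subseteq> U \<and> f \<in> regular X U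
        \<longrightarrow> restrict f V \<in> regular X V) \<and>
     (\<forall>U f. openin (zariski X) U \<and> f \<in> extensional U \<and>
        (\<forall>x\<in>U. \<exists>V. openin (zariski X) V \<and> x \<in> V \<and> V \<subseteq> U \<and> restrict f V \<in> regular X V)
        \<longrightarrow> f \<in> regular X U)"

definition variety_morphism ::
  "('a, 'k) fun_space \<Rightarrow> ('b, 'k) fun_space \<Rightarrow> ('a \<Rightarrow> 'b) \<Rightarrow> bool" where
  "variety_morphism X Y \<phi> \<longleftrightarrow>
     continuous_map (zariski X) (zariski Y) \<phi> \<and>
     (\<forall>V f. openin (zariski Y) V \<and> f \<in> regular Y V \<longrightarrow>
        (\<lambda>x\<in>{x \<in> points X. \<phi> x \<in> V}. f (\<phi> x)) \<in> regular X {x \<in> points X. \<phi> x \<in> V})"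

definition variety_isomorphic :: "('a, 'k) fun_space \<Rightarrow> ('b, 'k) fun_space \<Rightarrow> bool" where
  "variety_isomorphic X Y \<longleftrightarrow>
     (\<exists>\<phi> \<psi>. variety_morphism X Y \<phi> \<and> variety_morphism Y X \<psi> \<and>
        (\<forall>x\<in>points X. \<psi> (\<phi> x) = x) \<and> (\<forall>y\<in>points Y. \<phi> (\<psi> y) = y))"

definition open_subspace :: "('a, 'k) fun_space \<Rightarrow> 'a set \<Rightarrow> ('a, 'k) fun_space" where
  "open_subspace X U = \<lparr>zariski = subtopology (zariski X) U, regular = regular X\<rparr>"

text \<open>The \<open>'k\<close>-algebra of functions generated by \<open>F\<close>.\<close>

inductive_set generated_algebra :: "('a \<Rightarrow> 'k::field) set \<Rightarrow> ('a \<Rightarrow> 'k) set"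
  for F :: "('a \<Rightarrow> 'k) set" where
  const: "(\<lambda>x. a) \<in> generated_algebra F"
| gen: "f \<in> F \<Longrightarrow> f \<in> generated_algebra F"
| add: "f \<in> generated_algebra F \<Longrightarrow> g \<in> generated_algebra F \<Longrightarrow> (\<lambda>x. f x + g x) \<in> generated_algebra F"
| mult: "f \<in> generated_algebra F \<Longrightarrow> g \<in> generated_algebra F \<Longrightarrow> (\<lambda>x. f x * g x) \<in> generated_algebra F"

subsection \<open>Affine varieties\<close>

definition affine_space :: "nat \<Rightarrow> (nat \<Rightarrow> 'k) set" where
  "affine_space n = {..<n} \<rightarrow>\<^sub>E UNIV"

definition polynomial_functions :: "nat \<Rightarrow> ((nat \<Rightarrow> 'k::field) \<Rightarrow> 'k) set" where
  "polynomial_functions n = generated_algebra {\<lambda>x. x i | i. i < n}"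

definition algebraic_set :: "nat \<Rightarrow> (nat \<Rightarrow> 'k::field) set \<Rightarrow> bool" where
  "algebraic_set n Z \<longleftrightarrow>
     (\<exists>S \<subseteq> polynomial_functions n. Z = {x \<in> affine_space n. \<forall>p\<in>S. p x = 0})"

definition affine_zariski :: "nat \<Rightarrow> (nat \<Rightarrow> 'k::field) topology" where
  "affine_zariski n = topology (\<lambda>U. U \<subseteq> affine_space n \<and> algebraic_set n (affine_space n - U))"

lemma istopology_affine_zariski:
  "istopology (\<lambda>U. U \<subseteq> affine_space n \<and> algebraic_set n (affine_space n - U :: (nat \<Rightarrow> 'k::field) set))"
  unfolding istopology_def
proof (intro conjI allI impI)
  fix U V :: "(nat \<Rightarrow> 'k) set"
  assume U: "U \<subseteq> affine_space n \<and> algebraic_set n (affine_space n - U)"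
    and V: "V \<subseteq> affine_space n \<and> algebraic_set n (affine_space n - V)"
  show "U \<inter> V \<subseteq> affine_space n" using U by blast
  obtain S where S: "S \<subseteq> polynomial_functions n"
    "affine_space n - U = {x \<in> affine_space n. \<forall>p\<in>S. p x = 0}"
    using U unfolding algebraic_set_def by blast
  obtain R where R: "R \<subseteq> polynomial_functions n"
    "affine_space n - V = {x \<in> affine_space n. \<forall>p\<in>R. p x = 0}"
    using V unfolding algebraic_set_def by blast
  let ?Q = "(\<lambda>(p, q). \<lambda>x. p x * q x) ` (S \<times> R)"
  have "?Q \<subseteq> polynomial_functions n"
    using S(1) R(1) unfolding polynomial_functions_def by (auto intro: generated_algebra.mult)
  moreover have "affine_space n - (U \<inter> V) = {x \<in> affine_space n. \<forall>p\<in>?Q. p x = 0}" (is "?L = ?R")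
  proof -
    have "x \<in> ?L \<longleftrightarrow> x \<in> ?R" if x: "x \<in> affine_space n" for x
    proof -
      have "x \<in> ?L \<longleftrightarrow> x \<in> affine_space n - U \<or> x \<in> affine_space n - V" using x by simp
      also have "\<dots> \<longleftrightarrow> (\<forall>p\<in>S. p x = 0) \<or> (\<forall>q\<in>R. q x = 0)"
        unfolding S(2) R(2) using x by simp
      also have "\<dots> \<longleftrightarrow> (\<forall>p\<in>S. \<forall>q\<in>R. p x * q x = 0)" by auto
      also have "\<dots> \<longleftrightarrow> x \<in> ?R" using x by (simp add: split_def)
      finally show ?thesis .
    qed
    moreover have "?L \<subseteq> affine_space n" "?R \<subseteq> affine_space n" by auto
    ultimately show ?thesis by (meson equalityI subsetD subsetI)
  qed
  ultimately show "algebraic_set n (affine_space n - U \<inter> V)"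
    unfolding algebraic_set_def by blast
next
  fix \<U> :: "(nat \<Rightarrow> 'k) set set"
  assume \<U>: "\<forall>U\<in>\<U>. U \<subseteq> affine_space n \<and> algebraic_set n (affine_space n - U)"
  then show "\<Union>\<U> \<subseteq> affine_space n" by blast
  have "\<forall>U\<in>\<U>. \<exists>S. S \<subseteq> polynomial_functions n \<and>
      affine_space n - U = {x \<in> affine_space n. \<forall>p\<in>S. p x = 0}"
    using \<U> unfolding algebraic_set_def by simp
  then obtain S where S: "\<forall>U\<in>\<U>. S U \<subseteq> polynomial_functions n \<and>
      affine_space n - U = {x \<in> affine_space n. \<forall>p\<in>S U. p x = 0}"
    by (auto dest!: bchoice)
  have "affine_space n - \<Union>\<U> = {x \<in> affine_space n. \<forall>p\<in>(\<Union>U\<in>\<U>. S U). p x = 0}"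
  proof -
    have "x \<notin> \<Union>\<U> \<longleftrightarrow> (\<forall>p\<in>(\<Union>U\<in>\<U>. S U). p x = 0)" if x: "x \<in> affine_space n" for x
    proof -
      have "x \<notin> U \<longleftrightarrow> (\<forall>p\<in>S U. p x = 0)" if "U \<in> \<U>" for U
      proof -
        have "x \<notin> U \<longleftrightarrow> x \<in> affine_space n - U" using x by simp
        also have "\<dots> \<longleftrightarrow> x \<in> {x \<in> affine_space n. \<forall>p\<in>S U. p x = 0}" using S that by simp
        finally show ?thesis using x by simp
      qed
      then show ?thesis by simp
    qed
    then show ?thesis by auto
  qed
  moreover have "(\<Union>U\<in>\<U>. S U) \<subseteq> polynomial_functions n" using S by blast
  ultimately show "algebraic_set n (affine_space n - \<Union>\<U>)"
    unfolding algebraic_set_def by blast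
qed

lemma openin_affine_zariski:
  "openin (affine_zariski n) U \<longleftrightarrow> U \<subseteq> affine_space n \<and> algebraic_set n (affine_space n - U)"
  unfolding affine_zariski_def by (simp add: topology_inverse'[OF istopology_affine_zariski])

definition algebraic_set_space :: "nat \<Rightarrow> (nat \<Rightarrow> 'k::field) set \<Rightarrow> (nat \<Rightarrow> 'k, 'k) fun_space" where
  "algebraic_set_space n Z =
     \<lparr>zariski = subtopology (affine_zariski n) Z,
      regular = (\<lambda>U. {f \<in> extensional U. \<forall>x\<in>U. \<exists>V p q.
        openin (subtopology (affine_zariski n) Z) V \<and> x \<in> V \<and> V \<subseteq> U \<and>
        p \<in> polynomial_functions n \<and> q \<in> polynomial_functions n \<and>
        (\<forall>y\<in>V. q y \<noteq> 0 \<and> f y = p y / q y)})\<rparr>"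

definition affine_variety :: "('a, 'k::field) fun_space \<Rightarrow> bool" where
  "affine_variety X \<longleftrightarrow> (\<exists>n Z. algebraic_set n Z \<and> variety_isomorphic X (algebraic_set_space n Z))"

definition algebraic_variety :: "('a, 'k::alg_closed_field) fun_space \<Rightarrow> bool" where
  "algebraic_variety X \<longleftrightarrow> space_with_functions X \<and>
     (\<exists>\<U>. finite \<U> \<and> \<Union>\<U> = points X \<and>
        (\<forall>U\<in>\<U>. openin (zariski X) U \<and> affine_variety (open_subspace X U)))"

subsection \<open>Fibered powers\<close>

text \<open>
  \<open>variety_power I X\<close> is the fibered product over \<open>'k\<close> of copies of \<open>X\<close> indexed by the finite set \<open>I\<close>.
  On an open box, the functions \<open>h\<close> below are the sums of products of functions pulled back from the
  factors (the image of the tensor product of the algebras \<open>regular X (U i)\<close>). The loci \<open>h \<noteq> 0\<close> form a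
  base of the Zariski topology of the product, which is finer than the product topology, and the
  regular functions are locally quotients of such functions.
\<close>

definition box_functions ::
  "'i set \<Rightarrow> ('a, 'k::field) fun_space \<Rightarrow> ('i \<Rightarrow> 'a set) \<Rightarrow> (('i \<Rightarrow> 'a) \<Rightarrow> 'k) set" where
  "box_functions I X U = generated_algebra {\<lambda>x. f (x i) | f i. i \<in> I \<and> f \<in> regular X (U i)}"

definition basic_open :: "'i set \<Rightarrow> ('i \<Rightarrow> 'a set) \<Rightarrow> (('i \<Rightarrow> 'a) \<Rightarrow> 'k::field) \<Rightarrow> ('i \<Rightarrow> 'a) set" where
  "basic_open I U h = {x \<in> Pi\<^sub>E I U. h x \<noteq> 0}"

definition variety_power :: "'i set \<Rightarrow> ('a, 'k::field) fun_space \<Rightarrow> ('i \<Rightarrow> 'a, 'k) fun_space" where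
  "variety_power I X =
     \<lparr>zariski = topology_generated_by
        {basic_open I U h | U h. (\<forall>i\<in>I. openin (zariski X) (U i)) \<and> h \<in> box_functions I X U},
      regular = (\<lambda>W. {f \<in> extensional W. \<forall>x\<in>W. \<exists>U g h.
        (\<forall>i\<in>I. openin (zariski X) (U i)) \<and> g \<in> box_functions I X U \<and> h \<in> box_functions I X U \<and>
        x \<in> basic_open I U h \<and> basic_open I U h \<subseteq> W \<and>
        (\<forall>y\<in>basic_open I U h. f y = g y / h y)})\<rparr>"

subsection \<open>Krull dimension\<close>

definition irreducible_closed :: "'a topology \<Rightarrow> 'a set \<Rightarrow> bool" where
  "irreducible_closed T Z \<longleftrightarrow> closedin T Z \<and> Z \<noteq> {} \<and>
     (\<forall>A B. closedin T A \<and> closedin T B \<and> Z \<subseteq> A \<union> B \<longrightarrow> Z \<subseteq> A \<or> Z \<subseteq> B)"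

text \<open>With values in \<^typ>\<open>ereal\<close>, the supremum is \<open>-\<infinity>\<close> for the empty space.\<close>

definition krull_dim :: "'a topology \<Rightarrow> ereal" where
  "krull_dim T = Sup {ereal (real n) | n. \<exists>Z :: nat \<Rightarrow> 'a set.
     (\<forall>i\<le>n. irreducible_closed T (Z i)) \<and> (\<forall>i<n. Z i \<subset> Z (Suc i))}"

section \<open>Algebraic groups\<close>

record ('a, 'k) alg_group = "'a monoid" +
  variety :: "('a, 'k) fun_space"

text \<open>\<open>X \<times> X\<close> is represented as the power of \<open>X\<close> with index set \<open>UNIV :: bool set\<close>.\<close>

definition algebraic_group :: "('a, 'k::alg_closed_field) alg_group \<Rightarrow> bool" where
  "algebraic_group X \<longleftrightarrow> group X \<and> algebraic_variety (variety X) \<and> points (variety X) = carrier X \<and>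
     variety_morphism (variety_power (UNIV :: bool set) (variety X)) (variety X)
       (\<lambda>p. p False \<otimes>\<^bsub>X\<^esub> p True) \<and>
     variety_morphism (variety X) (variety X) (\<lambda>x. inv\<^bsub>X\<^esub> x)"

definition alg_group_power ::
  "'i set \<Rightarrow> ('a, 'k::alg_closed_field) alg_group \<Rightarrow> ('i \<Rightarrow> 'a, 'k) alg_group" where
  "alg_group_power I X = monoid.extend (product_group I (\<lambda>_. X))
     (alg_group.fields (variety_power I (variety X)))"

definition alg_group_hom ::
  "('a, 'k::alg_closed_field) alg_group \<Rightarrow> ('b, 'k) alg_group \<Rightarrow> ('a \<Rightarrow> 'b) set" where
  "alg_group_hom X Y = {\<phi> \<in> hom X Y. variety_morphism (variety X) (variety Y) \<phi>}"

section \<open>Cellular automata\<close>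

definition finitely_generated_group :: "('g, 'm) monoid_scheme \<Rightarrow> bool" where
  "finitely_generated_group G \<longleftrightarrow>
     group G \<and> (\<exists>S. finite S \<and> S \<subseteq> carrier G \<and> generate G S = carrier G)"

abbreviation configurations :: "('g, 'm) monoid_scheme \<Rightarrow> 'a set \<Rightarrow> ('g \<Rightarrow> 'a) set" where
  "configurations G A \<equiv> carrier G \<rightarrow>\<^sub>E A"

definition shift :: "('g, 'm) monoid_scheme \<Rightarrow> 'g \<Rightarrow> ('g \<Rightarrow> 'a) \<Rightarrow> 'g \<Rightarrow> 'a" where
  "shift G g c = (\<lambda>h\<in>carrier G. c (inv\<^bsub>G\<^esub> g \<otimes>\<^bsub>G\<^esub> h))"

definition local_defining_map ::
  "('g, 'm) monoid_scheme \<Rightarrow> 'a set \<Rightarrow> (('g \<Rightarrow> 'a) \<Rightarrow> 'g \<Rightarrow> 'a) \<Rightarrow> 'g set \<Rightarrow> (('g \<Rightarrow> 'a) \<Rightarrow> 'a) \<Rightarrow> bool" where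
  "local_defining_map G A \<tau> M \<mu> \<longleftrightarrow> finite M \<and> M \<subseteq> carrier G \<and> \<mu> \<in> (M \<rightarrow>\<^sub>E A) \<rightarrow> A \<and>
     (\<forall>c\<in>configurations G A. \<forall>g\<in>carrier G. \<tau> c g = \<mu> (restrict (shift G (inv\<^bsub>G\<^esub> g) c) M))"

definition memory_set ::
  "('g, 'm) monoid_scheme \<Rightarrow> 'a set \<Rightarrow> (('g \<Rightarrow> 'a) \<Rightarrow> 'g \<Rightarrow> 'a) \<Rightarrow> 'g set \<Rightarrow> bool" where
  "memory_set G A \<tau> M \<longleftrightarrow> (\<exists>\<mu>. local_defining_map G A \<tau> M \<mu>)"

definition cellular_automata ::
  "('g, 'm) monoid_scheme \<Rightarrow> 'a set \<Rightarrow> (('g \<Rightarrow> 'a) \<Rightarrow> 'g \<Rightarrow> 'a) set" where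
  "cellular_automata G A =
     {\<tau> \<in> configurations G A \<rightarrow>\<^sub>E configurations G A. \<exists>M. memory_set G A \<tau> M}"

definition CA_algr ::
  "('g, 'm) monoid_scheme \<Rightarrow> ('a, 'k::alg_closed_field) alg_group \<Rightarrow> (('g \<Rightarrow> 'a) \<Rightarrow> 'g \<Rightarrow> 'a) set" where
  "CA_algr G X = {\<tau> \<in> cellular_automata G (carrier X).
     \<exists>M \<mu>. local_defining_map G (carrier X) \<tau> M \<mu> \<and> \<mu> \<in> alg_group_hom (alg_group_power M X) X}"

definition pad ::
  "('g, 'm) monoid_scheme \<Rightarrow> ('a, 'k) alg_group \<Rightarrow> 'g set \<Rightarrow> ('g \<Rightarrow> 'a) set \<Rightarrow> ('g \<Rightarrow> 'a) set" where
  "pad G X \<Omega> D = {c \<in> configurations G (carrier X).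
     restrict c \<Omega> \<in> D \<and> (\<forall>g\<in>carrier G - \<Omega>. c g = \<one>\<^bsub>X\<^esub>)}"

text \<open>
  Only meant for \<open>\<tau> \<in> CA_algr G X\<close>. The image is viewed inside \<open>A\<close> to the power \<open>\<Omega> M\<inverse>\<close>. Its
  dimension there is the same for all memory sets \<open>M\<close> of \<open>\<tau>\<close>, since enlarging \<open>M\<close> amounts to a closed
  embedding padding with the neutral element.
\<close>

definition bullet_bullet_pre_injective ::
  "('g, 'm) monoid_scheme \<Rightarrow> ('a, 'k::alg_closed_field) alg_group \<Rightarrow> (('g \<Rightarrow> 'a) \<Rightarrow> 'g \<Rightarrow> 'a) \<Rightarrow> bool" where
  "bullet_bullet_pre_injective G X \<tau> \<longleftrightarrow>
     (\<forall>M \<Omega>. memory_set G (carrier X) \<tau> M \<and> finite \<Omega> \<and> \<Omega> \<subseteq> carrier G \<longrightarrow>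
        (let N = {\<omega> \<otimes>\<^bsub>G\<^esub> inv\<^bsub>G\<^esub> m | \<omega> m. \<omega> \<in> \<Omega> \<and> m \<in> M} in
         krull_dim (subtopology (zariski (variety_power N (variety X)))
             ((\<lambda>c. restrict (\<tau> c) N) ` pad G X \<Omega> (\<Omega> \<rightarrow>\<^sub>E carrier X)))
         = krull_dim (zariski (variety_power \<Omega> (variety X)))))"

end

theory Submission
  imports Defs
begin

text \<open>
  A finite algebraic group carries the discrete topology, so every nonempty subspace of each of its
  powers has Krull dimension zero. Hence every cellular automaton in \<open>CA_algr G X\<close> is
  \<open>(\<bullet>\<bullet>)\<close>-pre-injective as soon as \<open>X\<close> is finite, and the trivial one over the group of order two is
  not surjective.
\<close>

section \<open>Discrete spaces with functions and their powers\<close>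

text \<open>Only one inclusion is demanded of \<open>regular\<close>: it is the direction that turns
  every map out of the space into a morphism.\<close>

definition discrete_space :: "('a, 'k) fun_space \<Rightarrow> bool" where
  "discrete_space X \<longleftrightarrow> zariski X = discrete_topology (points X) \<and>
     (\<forall>W\<subseteq>points X. extensional W \<subseteq> regular X W)"

lemma discrete_spaceI:
  assumes "\<And>x. x \<in> points X \<Longrightarrow> openin (zariski X) {x}"
    and "\<And>W. W \<subseteq> points X \<Longrightarrow> extensional W \<subseteq> regular X W"
  shows "discrete_space X"
  unfolding discrete_space_def
  using assms by (metis discrete_topology_unique)

lemma openin_discrete_space:
  "discrete_space X \<Longrightarrow> openin (zariski X) U \<longleftrightarrow> U \<subseteq> points X"
  unfolding discrete_space_def by (metis openin_discrete_topology)

text \<open>Preimages of open sets are open because all subsets are, and a pulled-back function is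
  regular because all functions are. Every morphism below is obtained this way.\<close>

lemma variety_morphism_discrete:
  assumes "discrete_space X" and "\<phi> \<in> points X \<rightarrow> points Y"
  shows "variety_morphism X Y \<phi>"
  unfolding variety_morphism_def
proof (intro conjI allI impI)
  show "continuous_map (zariski X) (zariski Y) \<phi>"
    unfolding continuous_map_def using assms by (auto simp: openin_discrete_space)
  fix V f
  have "extensional {x \<in> points X. \<phi> x \<in> V} \<subseteq> regular X {x \<in> points X. \<phi> x \<in> V}"
    using assms(1) by (auto simp: discrete_space_def)
  then show "(\<lambda>x\<in>{x \<in> points X. \<phi> x \<in> V}. f (\<phi> x)) \<in> regular X {x \<in> points X. \<phi> x \<in> V}"
    using restrict_extensional by blast
qed

text \<open>A box is the nonvanishing locus of the constant 1 on it, hence one of the generating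
  sets of the topology.\<close>

lemma openin_variety_power:
  fixes X :: "('a, 'k::field) fun_space"
  assumes "\<And>i. i \<in> I \<Longrightarrow> openin (zariski X) (U i)"
  shows "openin (zariski (variety_power I X)) (Pi\<^sub>E I U)"
proof -
  have "Pi\<^sub>E I U = basic_open I U (\<lambda>_. 1 :: 'k)" by (simp add: basic_open_def)
  moreover have "(\<lambda>_. 1) \<in> box_functions I X U"
    unfolding box_functions_def by (rule generated_algebra.const)
  ultimately have "Pi\<^sub>E I U \<in> {basic_open I U h | U h.
      (\<forall>i\<in>I. openin (zariski X) (U i)) \<and> h \<in> box_functions I X U}"
    using assms by blast
  then show ?thesis
    unfolding variety_power_def by (simp add: topology_generated_by_Basis)
qed

lemma points_variety_power: "points (variety_power I X) = (I \<rightarrow>\<^sub>E points X)"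
proof
  show "points (variety_power I X) \<subseteq> (I \<rightarrow>\<^sub>E points X)"
  proof
    fix x assume "x \<in> points (variety_power I X)"
    then obtain U where "\<forall>i\<in>I. openin (zariski X) (U i)" "x \<in> Pi\<^sub>E I U"
      by (auto simp: variety_power_def topology_generated_by_topspace basic_open_def)
    then show "x \<in> (I \<rightarrow>\<^sub>E points X)"
      by (meson PiE_mono openin_subset subsetD)
  qed
  \<comment> \<open>The full power is itself an open box, with every side equal to
    \<open>points X\<close>.\<close>
  show "(I \<rightarrow>\<^sub>E points X) \<subseteq> points (variety_power I X)"
    by (intro openin_subset openin_variety_power) simp
qed

text \<open>A point of the power is the box of its singleton coordinates, so it is open; regularity
  then only has to be checked on one-point boxes.\<close>

lemma discrete_space_variety_power:
  fixes X :: "('a, 'k::field) fun_space"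
  assumes "discrete_space X"
  shows "discrete_space (variety_power I X)"
proof (rule discrete_spaceI)
  have box: "(\<forall>i\<in>I. openin (zariski X) {x i}) \<and> Pi\<^sub>E I (\<lambda>i. {x i}) = {x}"
    if "x \<in> points (variety_power I X)" for x
  proof -
    have "x \<in> extensional I" "\<forall>i\<in>I. x i \<in> points X"
      using that by (simp_all add: points_variety_power PiE_iff)
    then show ?thesis using assms by (simp add: PiE_singleton openin_discrete_space)
  qed
  then show "openin (zariski (variety_power I X)) {x}"
    if "x \<in> points (variety_power I X)" for x
    using that openin_variety_power[of I X "\<lambda>i. {x i}"] by simp
  fix W assume W: "W \<subseteq> points (variety_power I X)"
  show "extensional W \<subseteq> regular (variety_power I X) W"
  proof
    fix f :: "('b \<Rightarrow> 'a) \<Rightarrow> 'k" assume f: "f \<in> extensional W"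
    have "\<exists>U g h. (\<forall>i\<in>I. openin (zariski X) (U i)) \<and> g \<in> box_functions I X U \<and>
        h \<in> box_functions I X U \<and> x \<in> basic_open I U h \<and> basic_open I U h \<subseteq> W \<and>
        (\<forall>y\<in>basic_open I U h. f y = g y / h y)" if "x \<in> W" for x
      using that W box[of x]
      \<comment> \<open>On the one-point box around \<open>x\<close>, the function \<open>f\<close>
        is the constant \<open>f x\<close> divided by 1.\<close>
      by (intro exI[of _ "\<lambda>i. {x i}"] exI[of _ "\<lambda>_. f x"] exI[of _ "\<lambda>_. 1"])
        (auto simp: basic_open_def box_functions_def intro: generated_algebra.const)
    then show "f \<in> regular (variety_power I X) W"
      using f by (simp add: variety_power_def)
  qed
qed

lemma discrete_space_open_subspace:
  assumes "discrete_space X" and "U \<subseteq> points X"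
  shows "discrete_space (open_subspace X U)"
proof -
  have "zariski (open_subspace X U) = discrete_topology U"
    using assms unfolding discrete_space_def open_subspace_def
    by (metis fun_space.select_convs(1) inf.absorb_iff2 subtopology_discrete_topology)
  then show ?thesis
    using assms by (auto simp: discrete_space_def open_subspace_def)
qed

section \<open>The affine point and finite discrete varieties\<close>

lemma affine_space_0: "affine_space 0 = {\<lambda>_. undefined}"
  by (simp add: affine_space_def)

lemma algebraic_set_affine_space: "algebraic_set n (affine_space n)"
  unfolding algebraic_set_def by (intro exI[of _ "{}"]) simp

text \<open>The topology \<open>affine_zariski\<close> is known through its open sets, so the whole
  space must first be seen to be open: its complement is empty, the zero locus of the constant 1.
  The one point is the empty tuple, which as an extensional function is constantly
  \<open>undefined\<close>.\<close>

lemma points_affine_point: "points (algebraic_set_space 0 (affine_space 0)) = {\<lambda>_. undefined}"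
proof -
  have "algebraic_set 0 ({} :: (nat \<Rightarrow> 'a) set)"
    unfolding algebraic_set_def polynomial_functions_def
    by (intro exI[of _ "{\<lambda>_. 1}"]) (auto intro: generated_algebra.const)
  then have "openin (affine_zariski 0) (affine_space 0 :: (nat \<Rightarrow> 'a) set)"
    by (simp add: openin_affine_zariski)
  then show ?thesis
    unfolding algebraic_set_space_def
    by (metis affine_space_0 fun_space.select_convs(1) openin_subset topspace_subtopology_subset)
qed

lemma discrete_space_affine_point:
  "discrete_space (algebraic_set_space 0 (affine_space 0 :: (nat \<Rightarrow> 'k::field) set))"
    (is "discrete_space ?P")
proof (rule discrete_spaceI)
  \<comment> \<open>There is only one point, so its singleton is the whole space.\<close>
  show pt: "openin (zariski ?P) {x}" if "x \<in> points ?P" for x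
    using that openin_topspace[of "zariski ?P"] by (simp add: points_affine_point)
  fix W assume W: "W \<subseteq> points ?P"
  show "extensional W \<subseteq> regular ?P W"
  proof
    fix f :: "(nat \<Rightarrow> 'k) \<Rightarrow> 'k" assume f: "f \<in> extensional W"
    have "\<exists>V p q. openin (zariski ?P) V \<and> x \<in> V \<and> V \<subseteq> W \<and>
        p \<in> polynomial_functions 0 \<and> q \<in> polynomial_functions 0 \<and>
        (\<forall>y\<in>V. q y \<noteq> 0 \<and> f y = p y / q y)" if "x \<in> W" for x
      using that W pt[of x]
      by (intro exI[of _ "{x}"] exI[of _ "\<lambda>_. f x"] exI[of _ "\<lambda>_. 1"])
        (auto simp: polynomial_functions_def intro: generated_algebra.const)
    then show "f \<in> regular ?P W"
      using f by (simp add: algebraic_set_space_def)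
  qed
qed

text \<open>The two constant maps between \<open>X\<close> and affine 0-space are mutually inverse,
  and both are morphisms because both spaces are discrete.\<close>

lemma affine_variety_point:
  assumes "discrete_space X" and "points X = {x}"
  shows "affine_variety X"
  unfolding affine_variety_def
proof (intro exI conjI)
  show "algebraic_set 0 (affine_space 0)" by (rule algebraic_set_affine_space)
  show "variety_isomorphic X (algebraic_set_space 0 (affine_space 0))"
    unfolding variety_isomorphic_def
    by (intro exI[of _ "\<lambda>_. \<lambda>_. undefined"] exI[of _ "\<lambda>_. x"] conjI variety_morphism_discrete
        discrete_space_affine_point assms(1))
      (auto simp: assms(2) points_affine_point)
qed

lemma algebraic_variety_discrete:
  assumes "discrete_space X" and "finite (points X)" and "space_with_functions X"
  shows "algebraic_variety X"
  unfolding algebraic_variety_def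
proof (intro conjI exI ballI)
  \<comment> \<open>This assumption fixes the cover that \<open>exI\<close> left open: the
    singletons, finitely many and each an affine point.\<close>
  fix U assume "U \<in> (\<lambda>x. {x}) ` points X"
  then obtain x where x: "x \<in> points X" "U = {x}" by blast
  then show "openin (zariski X) U" using assms(1) by (simp add: openin_discrete_space)
  have "discrete_space (open_subspace X U)"
    using assms(1) x by (simp add: discrete_space_open_subspace)
  moreover have "points (open_subspace X U) = {x}" using x by (simp add: open_subspace_def)
  ultimately show "affine_variety (open_subspace X U)" by (rule affine_variety_point)
qed (use assms in auto)

section \<open>Finite groups as algebraic groups\<close>

text \<open>For finite \<open>A\<close> this is the disjoint union of copies of the affine point,
  one for each element of \<open>A\<close>.\<close>

definition discrete_fun_space :: "'a set \<Rightarrow> ('a, 'k) fun_space" where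
  "discrete_fun_space A = \<lparr>zariski = discrete_topology A, regular = extensional\<rparr>"

lemma points_discrete_fun_space [simp]: "points (discrete_fun_space A) = A"
  by (simp add: discrete_fun_space_def)

lemma discrete_space_discrete_fun_space: "discrete_space (discrete_fun_space A)"
  by (simp add: discrete_space_def discrete_fun_space_def)

lemma space_with_functions_discrete_fun_space: "space_with_functions (discrete_fun_space A)"
  by (auto simp: space_with_functions_def discrete_fun_space_def)

text \<open>Both \<open>X\<close> and the square of \<open>X\<close> are discrete, so multiplication
  and inversion are automatically morphisms.\<close>

lemma algebraic_group_discrete:
  assumes "group X" and "finite (carrier X)" and "variety X = discrete_fun_space (carrier X)"
  shows "algebraic_group X"
proof -
  interpret group X by fact
  have "discrete_space (variety X)"
    by (simp add: assms(3) discrete_space_discrete_fun_space)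
  moreover have "(\<lambda>p. p False \<otimes>\<^bsub>X\<^esub> p True) \<in> (UNIV \<rightarrow>\<^sub>E carrier X) \<rightarrow> carrier X"
    by (simp add: PiE_iff)
  ultimately show ?thesis
    unfolding algebraic_group_def using assms
    by (simp add: variety_morphism_discrete discrete_space_variety_power algebraic_variety_discrete
        points_variety_power space_with_functions_discrete_fun_space)
qed

section \<open>Krull dimension of discrete spaces and pre-injectivity\<close>

text \<open>If \<open>x\<close> lies in \<open>Z\<close>, the closed sets \<open>{x}\<close> and
  \<open>Z - {x}\<close> cover \<open>Z\<close>; irreducibility puts \<open>Z\<close> inside the
  first, since the second misses \<open>x\<close>.\<close>

lemma irreducible_closed_discrete_topology:
  "irreducible_closed (discrete_topology S) Z \<longleftrightarrow> (\<exists>x\<in>S. Z = {x})"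
proof
  assume Z: "irreducible_closed (discrete_topology S) Z"
  then obtain x where x: "x \<in> Z" and S: "Z \<subseteq> S"
    by (auto simp: irreducible_closed_def)
  then have "Z \<subseteq> {x} \<or> Z \<subseteq> Z - {x}"
    using Z unfolding irreducible_closed_def by (elim conjE allE[of _ "{x}"] allE[of _ "Z - {x}"]) auto
  then show "\<exists>x\<in>S. Z = {x}" using x S by blast
qed (auto simp: irreducible_closed_def)

text \<open>One singleton is never strictly contained in another, so chains have length 0.
  Nonemptiness supplies such a chain and keeps the supremum from being
  \<open>-\<infinity>\<close>.\<close>

lemma krull_dim_discrete_topology:
  assumes "S \<noteq> {}"
  shows "krull_dim (discrete_topology S) = 0"
proof -
  have "(\<exists>Z. (\<forall>i\<le>n. irreducible_closed (discrete_topology S) (Z i)) \<and> (\<forall>i<n. Z i \<subset> Z (Suc i)))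
      \<longleftrightarrow> n = 0" for n :: nat
  proof
    assume "\<exists>Z. (\<forall>i\<le>n. irreducible_closed (discrete_topology S) (Z i)) \<and> (\<forall>i<n. Z i \<subset> Z (Suc i))"
    then obtain Z where Z: "\<forall>i\<le>n. \<exists>x\<in>S. Z i = {x}" "\<forall>i<n. Z i \<subset> Z (Suc i)"
      by (auto simp: irreducible_closed_discrete_topology)
    show "n = 0"
    proof (rule ccontr)
      assume "n \<noteq> 0"
      then have "\<exists>x. Z 0 = {x}" "\<exists>y. Z (Suc 0) = {y}" "Z 0 \<subset> Z (Suc 0)"
        using Z(1)[rule_format, of 0] Z(1)[rule_format, of "Suc 0"] Z(2) by auto
      then show False by auto
    qed
  next
    obtain x where "x \<in> S" using assms by blast
    then show "\<exists>Z. (\<forall>i\<le>n. irreducible_closed (discrete_topology S) (Z i)) \<and> (\<forall>i<n. Z i \<subset> Z (Suc i))"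
      if "n = 0"
      using that by (intro exI[of _ "\<lambda>_. {x}"]) (auto simp: irreducible_closed_discrete_topology)
  qed
  then show ?thesis by (simp add: krull_dim_def)
qed

lemma krull_dim_subspace_discrete:
  assumes "discrete_space X" and "points X \<inter> S \<noteq> {}"
  shows "krull_dim (subtopology (zariski X) S) = 0"
  using assms unfolding discrete_space_def
  by (metis subtopology_discrete_topology krull_dim_discrete_topology)

text \<open>Discreteness makes both dimensions 0 once neither space is empty, so the proof consists
  of exhibiting points, for an arbitrary memory set.\<close>

lemma bullet_bullet_pre_injective_discrete:
  assumes "group G" and "group X" and X: "variety X = discrete_fun_space (carrier X)"
    and \<tau>: "\<tau> \<in> configurations G (carrier X) \<rightarrow> configurations G (carrier X)"
  shows "bullet_bullet_pre_injective G X \<tau>"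
  unfolding bullet_bullet_pre_injective_def Let_def
proof (intro allI impI, elim conjE)
  interpret G: group G by fact
  interpret X: group X by fact
  fix M \<Omega>
  assume M: "memory_set G (carrier X) \<tau> M" and \<Omega>: "\<Omega> \<subseteq> carrier G"
  define N where "N = {\<omega> \<otimes>\<^bsub>G\<^esub> inv\<^bsub>G\<^esub> m | \<omega> m. \<omega> \<in> \<Omega> \<and> m \<in> M}"
  have "M \<subseteq> carrier G"
    using M by (auto simp: memory_set_def local_defining_map_def)
  \<comment> \<open>This keeps the values of \<open>\<tau> c\<close> on \<open>N\<close> inside
    \<open>X\<close>, where they could otherwise be \<open>undefined\<close>.\<close>
  then have N: "N \<subseteq> carrier G" using \<Omega> by (auto simp: N_def)
  \<comment> \<open>The constant neutral configuration belongs to the padding of every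
    \<open>\<Omega>\<close>; its image is the required point.\<close>
  define c where "c = (\<lambda>g\<in>carrier G. \<one>\<^bsub>X\<^esub>)"
  have c: "c \<in> pad G X \<Omega> (\<Omega> \<rightarrow>\<^sub>E carrier X)"
    using \<Omega> by (auto simp: pad_def c_def)
  then have "\<tau> c \<in> configurations G (carrier X)"
    using \<tau> by (auto simp: pad_def)
  then have "restrict (\<tau> c) N \<in> points (variety_power N (variety X))"
    using N by (auto simp: points_variety_power X PiE_iff)
  then have ne: "points (variety_power N (variety X)) \<inter>
      (\<lambda>c. restrict (\<tau> c) N) ` pad G X \<Omega> (\<Omega> \<rightarrow>\<^sub>E carrier X) \<noteq> {}"
    using imageI[OF c, of "\<lambda>c. restrict (\<tau> c) N"] by (metis IntI empty_iff)
  have d: "discrete_space (variety_power I (variety X))" for I :: "'a set"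
    by (simp add: X discrete_space_variety_power discrete_space_discrete_fun_space)
  \<comment> \<open>A product is empty only if some factor is, and \<open>X\<close> contains its
    neutral element; this covers empty \<open>\<Omega>\<close> too.\<close>
  have ne': "points (variety_power \<Omega> (variety X)) \<noteq> {}"
    using X.one_closed by (auto simp: points_variety_power X PiE_eq_empty_iff)
  then have "krull_dim (zariski (variety_power \<Omega> (variety X))) = 0"
    using d by (metis discrete_space_def krull_dim_discrete_topology)
  then show "krull_dim (subtopology (zariski (variety_power
        {\<omega> \<otimes>\<^bsub>G\<^esub> inv\<^bsub>G\<^esub> m | \<omega> m. \<omega> \<in> \<Omega> \<and> m \<in> M} (variety X)))
        ((\<lambda>c. restrict (\<tau> c) {\<omega> \<otimes>\<^bsub>G\<^esub> inv\<^bsub>G\<^esub> m | \<omega> m. \<omega> \<in> \<Omega> \<and> m \<in> M}) `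
          pad G X \<Omega> (\<Omega> \<rightarrow>\<^sub>E carrier X)))
      = krull_dim (zariski (variety_power \<Omega> (variety X)))"
    using krull_dim_subspace_discrete[OF d ne] by (simp add: N_def)
qed

section \<open>The trivial cellular automaton\<close>

text \<open>The outer restriction places the map in the extensional function space demanded by
  \<open>cellular_automata\<close>.\<close>

definition trivial_CA :: "('g, 'm) monoid_scheme \<Rightarrow> ('a, 'n) monoid_scheme \<Rightarrow> ('g \<Rightarrow> 'a) \<Rightarrow> 'g \<Rightarrow> 'a" where
  "trivial_CA G X = (\<lambda>c\<in>configurations G (carrier X). \<lambda>g\<in>carrier G. \<one>\<^bsub>X\<^esub>)"

text \<open>The empty set serves as memory set. The local defining map is then the trivial
  homomorphism from the zeroth power of \<open>X\<close>, a morphism because that power is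
  discrete.\<close>

lemma trivial_CA_in_CA_algr:
  assumes "group X" and X: "variety X = discrete_fun_space (carrier X)"
  shows "trivial_CA G X \<in> CA_algr G X"
proof -
  interpret group X by fact
  have ldm: "local_defining_map G (carrier X) (trivial_CA G X) {} (\<lambda>_. \<one>\<^bsub>X\<^esub>)"
    by (simp add: local_defining_map_def trivial_CA_def)
  have "discrete_space (variety (alg_group_power {} X))"
    by (simp add: alg_group_power_def alg_group.defs monoid.defs X discrete_space_variety_power
        discrete_space_discrete_fun_space)
  then have "(\<lambda>_. \<one>\<^bsub>X\<^esub>) \<in> alg_group_hom (alg_group_power {} X) X"
    by (auto simp: alg_group_hom_def hom_def X intro!: variety_morphism_discrete)
  moreover have "trivial_CA G X \<in> cellular_automata G (carrier X)"
    using ldm by (auto simp: cellular_automata_def memory_set_def trivial_CA_def)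
  ultimately show ?thesis using ldm unfolding CA_algr_def by blast
qed

text \<open>The image is the single constant neutral configuration, which differs from the constant
  configuration with value \<open>x\<close>.\<close>

lemma trivial_CA_not_surj:
  assumes "group G" and "group X" and "x \<in> carrier X" and "x \<noteq> \<one>\<^bsub>X\<^esub>"
  shows "trivial_CA G X ` configurations G (carrier X) \<noteq> configurations G (carrier X)"
proof
  assume "trivial_CA G X ` configurations G (carrier X) = configurations G (carrier X)"
  moreover have "(\<lambda>g\<in>carrier G. x) \<in> configurations G (carrier X)"
    using assms(3) by simp
  ultimately obtain c where "(\<lambda>g\<in>carrier G. x) = trivial_CA G X c" "c \<in> configurations G (carrier X)"
    by (metis (no_types, lifting) imageE)
  \<comment> \<open>Restricted functions can only be told apart inside \<open>carrier G\<close>, so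
    they are compared at its neutral element.\<close>
  then have "(\<lambda>g\<in>carrier G. x) \<one>\<^bsub>G\<^esub> = (\<lambda>g\<in>carrier G. \<one>\<^bsub>X\<^esub>) \<one>\<^bsub>G\<^esub>"
    by (simp add: trivial_CA_def)
  moreover have "\<one>\<^bsub>G\<^esub> \<in> carrier G"
    using assms(1) by (simp add: group.is_monoid)
  ultimately show False using assms(4) by simp
qed

text \<open>The constant group of order two: two points over \<open>'k\<close>, whatever its
  characteristic.\<close>

definition cyclic2 :: "(nat, 'k) alg_group" where
  "cyclic2 = \<lparr>carrier = {0, 1}, monoid.mult = (\<lambda>a b. (a + b) mod 2), one = 0,
     variety = discrete_fun_space {0, 1}\<rparr>"

lemma group_cyclic2: "group cyclic2"
  by (rule groupI) (auto simp: cyclic2_def)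

theorem proposition7p3:
  fixes G :: "('g, 'm) monoid_scheme"
  assumes "finitely_generated_group G"
  shows "\<exists>(X :: (nat, 'k::alg_closed_field) alg_group) \<tau>.
    algebraic_group X \<and> finite (carrier X) \<and> \<tau> \<in> CA_algr G X \<and>
    bullet_bullet_pre_injective G X \<tau> \<and>
    \<not> \<tau> ` configurations G (carrier X) = configurations G (carrier X)"
proof (intro exI conjI)
  let ?X = "cyclic2 :: (nat, 'k) alg_group"
  have G: "group G" using assms by (simp add: finitely_generated_group_def)
  have X: "variety ?X = discrete_fun_space (carrier ?X)" by (simp add: cyclic2_def)
  show fin: "finite (carrier ?X)" by (simp add: cyclic2_def)
  show "algebraic_group ?X" by (rule algebraic_group_discrete[OF group_cyclic2 fin X])
  show CA: "trivial_CA G ?X \<in> CA_algr G ?X" by (rule trivial_CA_in_CA_algr[OF group_cyclic2 X])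
  then have "trivial_CA G ?X \<in> configurations G (carrier ?X) \<rightarrow> configurations G (carrier ?X)"
    by (auto simp: CA_algr_def cellular_automata_def)
  then show "bullet_bullet_pre_injective G ?X (trivial_CA G ?X)"
    by (rule bullet_bullet_pre_injective_discrete[OF G group_cyclic2 X])
  show "\<not> trivial_CA G ?X ` configurations G (carrier ?X) = configurations G (carrier ?X)"
    \<comment> \<open>Here 1 is the non-neutral element of \<open>cyclic2\<close>.\<close>
    by (rule trivial_CA_not_surj[OF G group_cyclic2, of 1]) (simp_all add: cyclic2_def)
qed

end
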